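(* Let $S$ be an idempotent semifield, let $V$ be a free $S$-module of finite rank $n$ with basis $e_1,\dots,e_n$, and let $w=\sum_I w_Ie_I\in\bigwedge^dV$ and $w'=\sum_J w'_Je_J\in\bigwedge^{d'}V$ be tropical Plücker vectors for which there exist nonzero coordinates $w_I$, $w'_J$ with $I\cap J=\varnothing$. Then the stable sum $L_w\oplus_{st}L_{w'}$ has tropical Plücker vector $w\wedge w'\in\bigwedge^{d+d'}V$.
   Context: An idempotent semifield $S$ is a (commutative) semiring satisfying all axioms of a field except the existence of additive inverses, and such that $s+s=s$ for all $s\in S$; its additive and multiplicative identities are $0$ and $1$. Write $[n]=\{1,\dots,n\}$, $I+j=I\cup\{j\}$, $I-j=I\smallsetminus\{j\}$, $V^\vee=\mathrm{Hom}_S(V,S)$, and let $x_1,\dots,x_n\in V^\vee$ be the dual basis. The tropical Grassmann algebra of $V$ is $\bigwedge V:=\mathrm{Sym}\,V/\langle e_i^2\sim 0\rangle_{i=1}^n$ (quotient by the generated $S$-algebra congruence), graded by $\bigwedge V=\bigoplus_{d\ge0}\bigwedge^dV$, with commutative product $\wedge$; $\bigwedge^dV$ is free with basis $e_I=e_{i_1}\wedge\cdots\wedge e_{i_d}$, $I\in\binom{[n]}{d}$. A nonzero $w=\sum_I w_Ie_I\in\bigwedge^dV$ is a tropical Plücker vector if for all $A\in\binom{[n]}{d+1}$, $B\in\binom{[n]}{d-1}$ and every $p\in A\smallsetminus B$, $\sum_{i\in A\smallsetminus B}w_{A-i}w_{B+i}=\sum_{i\in A\smallsetminus B,\, i\ne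 p}w_{A-i}w_{B+i}$. The tropical hyperplane of a linear form $f=\sum_i f_ix_i\in V^\vee$ is $f^\perp=\{v=\sum_i v_ie_i\in V : \sum_i f_iv_i=\sum_{i\ne j}f_iv_i \text{ for all } j\in[n]\}$, and the tropical linear space $L_w\subset V$ associated to $w$ is the intersection of the tropical hyperplanes of the linear forms $\sum_{i\in J}w_{J-i}x_i$, for all $J\in\binom{[n]}{d+1}$. For tropical Plücker vectors $w\in\bigwedge^dV$, $w'\in\bigwedge^{d'}V$ having nonzero coordinates $w_I,w'_J$ with disjoint indices $I,J$, the stable sum $L_w\oplus_{st}L_{w'}$ is defined as the tropical linear space whose tropical Plücker vector has $K$-th coordinate, for $K\in\binom{[n]}{d+d'}$, equal to $\sum_{I\sqcup J=K}w_Iw'_J$, the sum being over all partitions of $K$ into disjoint subsets $I$ and $J$ of sizes $d$ and $d'$. *)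

theory Defs
  imports Main "HOL-Library.Poly_Mapping"
begin

class idempotent_semifield = comm_semiring_1 +
  assumes add_idem: "a + a = a"
    and ex_mult_inverse: "a \<noteq> 0 \<Longrightarrow> \<exists>b. a * b = 1"

text \<open>The library's \<open>module\<close> locale needs additive inverses, so modules over a semiring
  are introduced here. The module is the whole type \<open>'v\<close>.\<close>

locale semimodule =
  fixes scale :: "'s::comm_semiring_1 \<Rightarrow> 'v::comm_monoid_add \<Rightarrow> 'v"
  assumes scale_add_right: "scale a (u + v) = scale a u + scale a v"
    and scale_add_left: "scale (a + b) v = scale a v + scale b v"
    and scale_scale: "scale a (scale b v) = scale (a * b) v"
    and scale_one: "scale 1 v = v"
    and scale_zero_left: "scale 0 v = 0"
    and scale_zero_right: "scale a 0 = 0"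

locale free_semimodule = semimodule scale
  for scale :: "'s::comm_semiring_1 \<Rightarrow> 'v::comm_monoid_add \<Rightarrow> 'v" +
  fixes n :: nat and e :: "nat \<Rightarrow> 'v"
  assumes basis: "\<exists>!c. (\<forall>i. i \<notin> {1..n} \<longrightarrow> c i = 0) \<and> v = (\<Sum>i\<in>{1..n}. scale (c i) (e i))"

definition dual_basis ::
  "('s::comm_semiring_1 \<Rightarrow> 'v::comm_monoid_add \<Rightarrow> 'v) \<Rightarrow> nat \<Rightarrow> (nat \<Rightarrow> 'v) \<Rightarrow> nat \<Rightarrow> 'v \<Rightarrow> 's"
  where "dual_basis scale n e i v =
    (THE c. (\<forall>i. i \<notin> {1..n} \<longrightarrow> c i = 0) \<and> v = (\<Sum>i\<in>{1..n}. scale (c i) (e i))) i"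

definition subsets_of_card :: "nat \<Rightarrow> nat \<Rightarrow> nat set set"
  where "subsets_of_card n d = {I. I \<subseteq> {1..n} \<and> card I = d}"


subsection \<open>The symmetric algebra and the Grassmann algebra\<close>

text \<open>\<open>('s, 'v) free_alg\<close> is the free commutative \<open>'s\<close>-algebra on the underlying set of \<open>V\<close>:
  polynomials over \<open>'s\<close> with one variable \<open>var v\<close> for each vector \<open>v\<close>. Dividing by the
  congruence generated by the linearity relations \<open>sym_rel\<close> gives \<open>Sym V\<close>.\<close>

type_synonym ('s, 'v) free_alg = "('v \<Rightarrow>\<^sub>0 nat) \<Rightarrow>\<^sub>0 's"

definition var :: "'v \<Rightarrow> ('s::comm_semiring_1, 'v) free_alg"
  where "var v = Poly_Mapping.single (Poly_Mapping.single v 1) 1"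

definition const :: "'s \<Rightarrow> ('s::comm_semiring_1, 'v) free_alg"
  where "const a = Poly_Mapping.single 0 a"

text \<open>Compatibility with scalars is the case of \<open>mult\<close> in which one pair is
  \<open>const a\<close>, \<open>const a\<close>; so this is the generated congruence of algebras.\<close>

inductive gen_cong :: "('a::comm_semiring_1 \<Rightarrow> 'a \<Rightarrow> bool) \<Rightarrow> 'a \<Rightarrow> 'a \<Rightarrow> bool"
  for R where
  base: "R p q \<Longrightarrow> gen_cong R p q"
| refl: "gen_cong R p p"
| sym: "gen_cong R p q \<Longrightarrow> gen_cong R q p"
| trans: "gen_cong R p q \<Longrightarrow> gen_cong R q r \<Longrightarrow> gen_cong R p r"
| add: "gen_cong R p q \<Longrightarrow> gen_cong R p' q' \<Longrightarrow> gen_cong R (p + p') (q + q')"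
| mult: "gen_cong R p q \<Longrightarrow> gen_cong R p' q' \<Longrightarrow> gen_cong R (p * p') (q * q')"

inductive sym_rel ::
  "('s::comm_semiring_1 \<Rightarrow> 'v::comm_monoid_add \<Rightarrow> 'v) \<Rightarrow> ('s, 'v) free_alg \<Rightarrow> ('s, 'v) free_alg \<Rightarrow> bool"
  for scale where
  sym_add: "sym_rel scale (var (u + v)) (var u + var v)"
| sym_scale: "sym_rel scale (var (scale a v)) (const a * var v)"

inductive square_rel ::
  "nat \<Rightarrow> (nat \<Rightarrow> 'v) \<Rightarrow> ('s::comm_semiring_1, 'v) free_alg \<Rightarrow> ('s, 'v) free_alg \<Rightarrow> bool"
  for n e where
  square: "i \<in> {1..n} \<Longrightarrow> square_rel n e (var (e i) ^ 2) 0"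

text \<open>\<open>Sym V / \<langle>e\<^sub>i\<^sup>2 \<sim> 0\<rangle>\<close> is the quotient of the free algebra by the congruence generated by
  both families of relations. Elements of the Grassmann algebra are the congruence classes.\<close>

definition grassmann_cong ::
  "('s::comm_semiring_1 \<Rightarrow> 'v::comm_monoid_add \<Rightarrow> 'v) \<Rightarrow> nat \<Rightarrow> (nat \<Rightarrow> 'v) \<Rightarrow>
   ('s, 'v) free_alg \<Rightarrow> ('s, 'v) free_alg \<Rightarrow> bool"
  where "grassmann_cong scale n e = gen_cong (\<lambda>p q. sym_rel scale p q \<or> square_rel n e p q)"

definition grassmann_class ::
  "('s::comm_semiring_1 \<Rightarrow> 'v::comm_monoid_add \<Rightarrow> 'v) \<Rightarrow> nat \<Rightarrow> (nat \<Rightarrow> 'v) \<Rightarrow>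
   ('s, 'v) free_alg \<Rightarrow> ('s, 'v) free_alg set"
  where "grassmann_class scale n e p = {q. grassmann_cong scale n e p q}"

definition homogeneous :: "nat \<Rightarrow> ('s::comm_semiring_1, 'v) free_alg \<Rightarrow> bool"
  where "homogeneous d p \<longleftrightarrow>
    (\<forall>m\<in>Poly_Mapping.keys p. (\<Sum>v\<in>Poly_Mapping.keys m. Poly_Mapping.lookup m v) = d)"

definition grassmann_graded ::
  "('s::comm_semiring_1 \<Rightarrow> 'v::comm_monoid_add \<Rightarrow> 'v) \<Rightarrow> nat \<Rightarrow> (nat \<Rightarrow> 'v) \<Rightarrow> nat \<Rightarrow>
   ('s, 'v) free_alg set set"
  where "grassmann_graded scale n e d = {grassmann_class scale n e p | p. homogeneous d p}"

definition wedge ::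
  "('s::comm_semiring_1 \<Rightarrow> 'v::comm_monoid_add \<Rightarrow> 'v) \<Rightarrow> nat \<Rightarrow> (nat \<Rightarrow> 'v) \<Rightarrow>
   ('s, 'v) free_alg set \<Rightarrow> ('s, 'v) free_alg set \<Rightarrow> ('s, 'v) free_alg set"
  where "wedge scale n e P Q = (\<Union>p\<in>P. \<Union>q\<in>Q. grassmann_class scale n e (p * q))"

lemma wedge_class:
  "wedge scale n e (grassmann_class scale n e p) (grassmann_class scale n e q) =
   grassmann_class scale n e (p * q)"
  unfolding wedge_def grassmann_class_def grassmann_cong_def
  by (blast intro: gen_cong.refl gen_cong.mult gen_cong.trans)

text \<open>The element with the given coordinates \<open>c I\<close> in the basis of \<open>d\<close>-fold products \<open>e\<^sub>I\<close>.\<close>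

definition grassmann_vector ::
  "('s::comm_semiring_1 \<Rightarrow> 'v::comm_monoid_add \<Rightarrow> 'v) \<Rightarrow> nat \<Rightarrow> (nat \<Rightarrow> 'v) \<Rightarrow> nat \<Rightarrow>
   (nat set \<Rightarrow> 's) \<Rightarrow> ('s, 'v) free_alg set"
  where "grassmann_vector scale n e d c =
    grassmann_class scale n e (\<Sum>I\<in>subsets_of_card n d. const (c I) * (\<Prod>i\<in>I. var (e i)))"

definition coordinate ::
  "('s::comm_semiring_1 \<Rightarrow> 'v::comm_monoid_add \<Rightarrow> 'v) \<Rightarrow> nat \<Rightarrow> (nat \<Rightarrow> 'v) \<Rightarrow> nat \<Rightarrow>
   ('s, 'v) free_alg set \<Rightarrow> nat set \<Rightarrow> 's"
  where "coordinate scale n e d w I =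
    (THE c. (\<forall>I. I \<notin> subsets_of_card n d \<longrightarrow> c I = 0) \<and> w = grassmann_vector scale n e d c) I"


subsection \<open>Tropical linear spaces\<close>

text \<open>The size of \<open>B\<close> is given by \<open>Suc (card B) = d\<close>, so that there is no such \<open>B\<close> if \<open>d = 0\<close>.\<close>

definition tropical_plucker ::
  "('s::comm_semiring_1 \<Rightarrow> 'v::comm_monoid_add \<Rightarrow> 'v) \<Rightarrow> nat \<Rightarrow> (nat \<Rightarrow> 'v) \<Rightarrow> nat \<Rightarrow>
   ('s, 'v) free_alg set \<Rightarrow> bool"
  where "tropical_plucker scale n e d w \<longleftrightarrow>
    w \<in> grassmann_graded scale n e d \<and> w \<noteq> grassmann_class scale n e 0 \<and>
    (\<forall>A B p. A \<subseteq> {1..n} \<and> card A = d + 1 \<and> B \<subseteq> {1..n} \<and> Suc (card B) = d \<and> p \<in> A - B \<longrightarrow>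
      (\<Sum>i\<in>A - B. coordinate scale n e d w (A - {i}) * coordinate scale n e d w (insert i B)) =
      (\<Sum>i\<in>A - B - {p}. coordinate scale n e d w (A - {i}) * coordinate scale n e d w (insert i B)))"

definition tropical_hyperplane ::
  "('s::comm_semiring_1 \<Rightarrow> 'v::comm_monoid_add \<Rightarrow> 'v) \<Rightarrow> nat \<Rightarrow> (nat \<Rightarrow> 'v) \<Rightarrow> ('v \<Rightarrow> 's) \<Rightarrow> 'v set"
  where "tropical_hyperplane scale n e f =
    {v. \<forall>j\<in>{1..n}. (\<Sum>i\<in>{1..n}. f (e i) * dual_basis scale n e i v) =
                   (\<Sum>i\<in>{1..n} - {j}. f (e i) * dual_basis scale n e i v)}"

definition tropical_linear_space ::
  "('s::comm_semiring_1 \<Rightarrow> 'v::comm_monoid_add \<Rightarrow> 'v) \<Rightarrow> nat \<Rightarrow> (nat \<Rightarrow> 'v) \<Rightarrow> nat \<Rightarrow>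
   ('s, 'v) free_alg set \<Rightarrow> 'v set"
  where "tropical_linear_space scale n e d w =
    (\<Inter>J\<in>subsets_of_card n (d + 1). tropical_hyperplane scale n e
      (\<lambda>v. \<Sum>i\<in>J. coordinate scale n e d w (J - {i}) * dual_basis scale n e i v))"

definition has_plucker_vector ::
  "('s::comm_semiring_1 \<Rightarrow> 'v::comm_monoid_add \<Rightarrow> 'v) \<Rightarrow> nat \<Rightarrow> (nat \<Rightarrow> 'v) \<Rightarrow> nat \<Rightarrow>
   'v set \<Rightarrow> ('s, 'v) free_alg set \<Rightarrow> bool"
  where "has_plucker_vector scale n e d L w \<longleftrightarrow>
    tropical_plucker scale n e d w \<and> L = tropical_linear_space scale n e d w"

text \<open>The stable sum of two tropical linear spaces is given through their Pluecker vectors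
  \<open>w\<close> and \<open>w'\<close>, of degrees \<open>d\<close> and \<open>d'\<close>.\<close>

definition stable_sum ::
  "('s::comm_semiring_1 \<Rightarrow> 'v::comm_monoid_add \<Rightarrow> 'v) \<Rightarrow> nat \<Rightarrow> (nat \<Rightarrow> 'v) \<Rightarrow>
   nat \<Rightarrow> ('s, 'v) free_alg set \<Rightarrow> nat \<Rightarrow> ('s, 'v) free_alg set \<Rightarrow> 'v set"
  where "stable_sum scale n e d w d' w' =
    tropical_linear_space scale n e (d + d') (grassmann_vector scale n e (d + d')
      (\<lambda>K. \<Sum>(I, J)\<in>{(I, J). I \<union> J = K \<and> I \<inter> J = {} \<and> card I = d \<and> card J = d'}.
        coordinate scale n e d w I * coordinate scale n e d' w' J))"

end

theory Submission
  imports Defs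
begin

text \<open>
  The coordinate of \<open>w \<and> w'\<close> at \<open>K\<close> is \<open>\<Sum> w\<^sub>I w'\<^sub>J\<close> over the partitions \<open>K = I \<squnion> J\<close>, because
  \<open>e\<^sub>I \<and> e\<^sub>J\<close> is \<open>e\<^bsub>I \<union> J\<^esub>\<close> for disjoint \<open>I\<close>, \<open>J\<close> and vanishes otherwise. These are the coordinates
  that define the stable sum. What has to be shown is that coordinates are well defined, that is, that
  the \<open>e\<^sub>I\<close> form a basis, and that \<open>w \<and> w'\<close> again satisfies the tropical Pluecker relations. The latter
  says that the union of two valuated matroids is a valuated matroid.

  \<^bold>\<open>The basis.\<close> Every element of degree \<open>d\<close> is congruent to a combination of the \<open>e\<^sub>I\<close> by induction on
  the degree (\<open>spanned_homogeneous\<close>). For uniqueness, expanding every vector in \<open>e\<^sub>1, \<dots>, e\<^sub>n\<close>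
  turns an element of the free algebra into an ordinary polynomial in \<open>n\<close> variables. The
  relations \<open>e\<^sub>i\<^sup>2 \<sim> 0\<close> affect only monomials with a square factor, and a square-free monomial is
  only a product of square-free ones, so the square-free coefficients depend only on the congruence
  class (\<open>squarefree_coeff_cong\<close>) and recover the coordinates.

  \<^bold>\<open>The Pluecker relations.\<close> In the order \<open>a \<sqsubseteq> b \<longleftrightarrow> a + b = b\<close>, dropping the summand \<open>p\<close> from a
  sum does not change it iff that summand lies below the sum of the others. Hence the Pluecker relations are
  the exchange property: for \<open>p \<in> J - I\<close>,
  \<open>w\<^sub>I w\<^sub>J \<sqsubseteq> \<Sum> w\<^bsub>I + p - i\<^esub> w\<^bsub>J - p + i\<^esub>\<close> over \<open>i \<in> I - J\<close>. A direct attack on the union, exchanging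
  alternately in \<open>w\<close> and in \<open>w'\<close>, may run in circles. Instead, \<open>w\<close> and \<open>w'\<close> are placed
  on two disjoint copies of the ground set, where their product has the exchange property for
  trivial reasons, and then the two copies \<open>x\<close>, \<open>y\<close> of one element after the other are
  merged into one. A single merge preserves the exchange property (\<open>exchange_merge\<close>). The only
  case that is not immediate is that of the products \<open>s = w\<^bsub>K + x\<^esub> w\<^bsub>L + y\<^esub>\<close> and
  \<open>t = w\<^bsub>K + y\<^esub> w\<^bsub>L + x\<^esub>\<close>. With \<open>g\<close> the bound to be reached, two exchanges give
  \<open>s \<sqsubseteq> g + t\<close>, and \<open>s t = (w\<^bsub>K + x\<^esub> w\<^bsub>L + x\<^esub>) (w\<^bsub>K + y\<^esub> w\<^bsub>L + y\<^esub>) \<sqsubseteq> g\<^sup>2\<close>; since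
  nonzero elements are invertible, this forces \<open>s \<sqsubseteq> g\<close>.
\<close>

section \<open>The natural order of an idempotent semifield\<close>

definition below :: "'s::idempotent_semifield \<Rightarrow> 's \<Rightarrow> bool"  (infix \<open>\<sqsubseteq>\<close> 50)
  where "a \<sqsubseteq> b \<longleftrightarrow> a + b = b"

lemma below_trans [trans]: "a \<sqsubseteq> b \<Longrightarrow> b \<sqsubseteq> c \<Longrightarrow> a \<sqsubseteq> c"
  by (metis add.assoc below_def)

lemma zero_below: "0 \<sqsubseteq> a"
  by (simp add: below_def)

lemma below_zero: "a \<sqsubseteq> 0 \<Longrightarrow> a = 0"
  by (simp add: below_def)

lemma below_add_left: "a \<sqsubseteq> a + b"
  by (metis add.assoc add_idem below_def)

lemma below_add_right: "b \<sqsubseteq> a + b"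
  by (metis add.commute below_add_left)

lemma add_below: "a \<sqsubseteq> c \<Longrightarrow> b \<sqsubseteq> c \<Longrightarrow> a + b \<sqsubseteq> c"
  by (simp add: below_def add.assoc)

lemma mult_below_left: "a \<sqsubseteq> b \<Longrightarrow> c * a \<sqsubseteq> c * b"
  unfolding below_def by (metis distrib_left)

lemma mult_below_mono: "a \<sqsubseteq> b \<Longrightarrow> c \<sqsubseteq> d \<Longrightarrow> a * c \<sqsubseteq> b * d"
  by (metis below_trans mult.commute mult_below_left)

lemma below_sum: "finite A \<Longrightarrow> i \<in> A \<Longrightarrow> f i \<sqsubseteq> sum f A"
  by (metis below_add_left sum.remove)

lemma sum_below: "(\<And>i. i \<in> A \<Longrightarrow> f i \<sqsubseteq> b) \<Longrightarrow> sum f A \<sqsubseteq> b"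
  by (induction A rule: infinite_finite_induct) (auto intro: add_below zero_below)

lemma mult_nonzero:
  fixes a b :: "'s::idempotent_semifield"
  assumes "a \<noteq> 0" "b \<noteq> 0"
  shows "a * b \<noteq> 0"
proof
  assume "a * b = 0"
  moreover obtain a' where "a * a' = 1"
    using ex_mult_inverse assms(1) by blast
  ultimately have "b = 0"
    by (metis mult.assoc mult.commute mult_1 mult_zero_right)
  with assms(2) show False by simp
qed

lemma below_mult_cancel:
  assumes "c * a \<sqsubseteq> c * b" "c \<noteq> 0"
  shows "a \<sqsubseteq> b"
proof -
  obtain c' where "c * c' = 1"
    using ex_mult_inverse assms(2) by blast
  then have "c' * (c * x) = x" for x
    by (metis mult.assoc mult.commute mult_1)
  with mult_below_left[OF assms(1), of c'] show ?thesis
    by simp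
qed

text \<open>If the order is total this is clear: \<open>s\<close> not below \<open>g\<close> would force \<open>s \<sqsubseteq> t\<close>, hence
  \<open>s\<^sup>2 \<sqsubseteq> g\<^sup>2\<close>. In general, the hypotheses give \<open>s\<^sup>2 \<sqsubseteq> (s + g) g\<close> and hence
  \<open>(s + g)\<^sup>2 \<sqsubseteq> (s + g) g\<close>, where the factor \<open>s + g\<close> cancels.\<close>

lemma below_of_mult_below_square:
  assumes "s \<sqsubseteq> g + t" "s * t \<sqsubseteq> g * g"
  shows "s \<sqsubseteq> g"
proof -
  have "s * s \<sqsubseteq> s * (g + t)"
    using assms(1) by (rule mult_below_left)
  also have "s * (g + t) = s * g + s * t"
    by (simp add: distrib_left)
  also have "\<dots> \<sqsubseteq> (s + g) * g"
    unfolding distrib_right using assms(2)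
    by (blast intro: add_below below_add_left below_add_right below_trans)
  finally have "s * s \<sqsubseteq> (s + g) * g" .
  moreover have "s * g \<sqsubseteq> (s + g) * g" "g * s \<sqsubseteq> (s + g) * g" "g * g \<sqsubseteq> (s + g) * g"
    using mult.commute[of g s] by (simp_all add: distrib_right below_add_left below_add_right)
  ultimately have square: "(s + g) * (s + g) \<sqsubseteq> (s + g) * g"
    by (simp add: distrib_left distrib_right add_below)
  show ?thesis
  proof (cases "s + g = 0")
    case True
    then have "s = 0"
      using below_add_left[of s g] below_zero by simp
    then show ?thesis by (simp add: zero_below)
  next
    case False
    with square have "s + g \<sqsubseteq> g" by (rule below_mult_cancel)
    with below_add_left show ?thesis by (rule below_trans)
  qed
qed


section \<open>The exchange property and merging two elements\<close>

text \<open>There is no condition on cardinalities. A function supported on sets of one size satisfies the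
  condition for all other pairs trivially, and both the product on two disjoint ground sets and the
  merging of elements are simpler to treat without it.\<close>

definition exchange :: "('a set \<Rightarrow> 's::idempotent_semifield) \<Rightarrow> bool"
  where "exchange w \<longleftrightarrow> (\<forall>I J p. finite I \<longrightarrow> finite J \<longrightarrow> p \<in> J - I \<longrightarrow>
    w I * w J \<sqsubseteq> (\<Sum>i\<in>I - J. w (insert p (I - {i})) * w (insert i (J - {p}))))"

lemma exchangeD:
  assumes "exchange w" "finite I" "finite J" "p \<in> J - I"
  shows "w I * w J \<sqsubseteq> (\<Sum>i\<in>I - J. w (insert p (I - {i})) * w (insert i (J - {p})))"
  using assms unfolding exchange_def by blast

lemma exchange_bound:
  assumes "exchange w" "finite I" "finite J" "p \<in> J - I"
    and "\<And>i. i \<in> I - J \<Longrightarrow> w (insert p (I - {i})) * w (insert i (J - {p})) \<sqsubseteq> b"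
  shows "w I * w J \<sqsubseteq> b"
proof -
  have "w I * w J \<sqsubseteq> (\<Sum>i\<in>I - J. w (insert p (I - {i})) * w (insert i (J - {p})))"
    using assms(1-4) by (rule exchangeD)
  also have "\<dots> \<sqsubseteq> b"
    using assms(5) by (rule sum_below)
  finally show ?thesis .
qed

text \<open>The push-forward of \<open>w\<close> along the map that identifies \<open>y\<close> with \<open>x\<close>, the merged element being
  called \<open>x\<close>. Sets that contain both \<open>x\<close> and \<open>y\<close> are lost, as \<open>e\<^sub>x\<^sup>2\<close> is zero in the Grassmann
  algebra.\<close>

definition merge :: "'a \<Rightarrow> 'a \<Rightarrow> ('a set \<Rightarrow> 's::idempotent_semifield) \<Rightarrow> 'a set \<Rightarrow> 's"
  where "merge x y w K =
    (if y \<in> K then 0 else w K + (if x \<in> K then w (insert y (K - {x})) else 0))"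

text \<open>Exchanging \<open>p\<close> into \<open>K + x\<close> yields products bounded by \<open>g\<close> and the product at
  \<open>K + p\<close>, \<open>L - p + x + y\<close>, whose second set would be lost in merging \<open>x\<close> and \<open>y\<close>. Exchanging \<open>y\<close> back
  out of that set leads to further products bounded by \<open>g\<close>, or returns \<open>p\<close> and so leaves \<open>x\<close> and
  \<open>y\<close> swapped.\<close>

lemma crossed_exchange:
  assumes ex: "exchange w" and fin: "finite K" "finite L"
    and xy: "x \<noteq> y" "x \<notin> K \<union> L" "y \<notin> K \<union> L" and p: "p \<in> L - K"
    and g: "\<And>i. i \<in> K - L \<Longrightarrow>
        w (insert x (insert p (K - {i}))) * w (insert y (insert i (L - {p}))) \<sqsubseteq> g"
      "\<And>i. i \<in> K - L \<Longrightarrow>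
        w (insert y (insert p (K - {i}))) * w (insert x (insert i (L - {p}))) \<sqsubseteq> g"
  shows "w (insert x K) * w (insert y L) \<sqsubseteq> g + w (insert y K) * w (insert x L)"
    (is "_ \<sqsubseteq> ?b")
proof (rule exchange_bound[OF ex, where p = p])
  have both: "w (insert p K) * w (insert x (insert y (L - {p}))) \<sqsubseteq> ?b"
  proof (rule exchange_bound[OF ex, where p = y])
    fix i assume i: "i \<in> insert p K - insert x (insert y (L - {p}))"
    show "w (insert y (insert p K - {i})) *
        w (insert i (insert x (insert y (L - {p})) - {y})) \<sqsubseteq> ?b"
    proof (cases "i = p")
      case True
      then have "insert y (insert p K - {i}) = insert y K"
        "insert i (insert x (insert y (L - {p})) - {y}) = insert x L"
        using xy p by auto
      then show ?thesis by (simp add: below_add_right)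
    next
      case False
      then have "insert y (insert p K - {i}) = insert y (insert p (K - {i}))"
        "insert i (insert x (insert y (L - {p})) - {y}) = insert x (insert i (L - {p}))"
        using xy i p by auto
      moreover have "i \<in> K - L" using i False by auto
      ultimately show ?thesis
        using g(2) below_add_left below_trans by metis
    qed
  qed (use fin xy p in auto)
  fix i assume i: "i \<in> insert x K - insert y L"
  show "w (insert p (insert x K - {i})) * w (insert i (insert y L - {p})) \<sqsubseteq> ?b"
  proof (cases "i = x")
    case True
    then have "insert p (insert x K - {i}) = insert p K"
      "insert i (insert y L - {p}) = insert x (insert y (L - {p}))"
      using xy p by auto
    then show ?thesis using both by simp
  next
    case False
    then have "insert p (insert x K - {i}) = insert x (insert p (K - {i}))"
      "insert i (insert y L - {p}) = insert y (insert i (L - {p}))"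
      using xy p by auto
    moreover have "i \<in> K - L" using i False by auto
    ultimately show ?thesis
      using g(1) below_add_left below_trans by metis
  qed
qed (use fin xy p in auto)

text \<open>A product of values of \<open>merge x y w\<close> expands into products of values of \<open>w\<close>, and an exchange for
  \<open>w\<close> projects to one for \<open>merge x y w\<close> unless it puts \<open>x\<close> and \<open>y\<close> into the same set. This
  can happen only if \<open>x\<close> lies in \<open>I\<close> and in \<open>J\<close> and the two factors use different preimages of it, which
  is settled by \<open>crossed_exchange\<close> and \<open>below_of_mult_below_square\<close>.\<close>

lemma exchange_merge:
  fixes w :: "'a set \<Rightarrow> 's::idempotent_semifield"
  assumes ex: "exchange w" and "x \<noteq> y"
  shows "exchange (merge x y w)"
  unfolding exchange_def
proof (intro allI impI)
  fix I J :: "'a set" and p assume fin: "finite I" "finite J" and p: "p \<in> J - I"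
  let ?u = "merge x y w"
  define g where "g = (\<Sum>i\<in>I - J. ?u (insert p (I - {i})) * ?u (insert i (J - {p})))"
  have g: "a * b \<sqsubseteq> g"
    if "i \<in> I - J" "a \<sqsubseteq> ?u (insert p (I - {i}))" "b \<sqsubseteq> ?u (insert i (J - {p}))" for a b i
  proof -
    have "?u (insert p (I - {i})) * ?u (insert i (J - {p})) \<sqsubseteq> g"
      unfolding g_def using fin that(1) by (intro below_sum) auto
    with mult_below_mono[OF that(2,3)] show ?thesis by (rule below_trans)
  qed
  have lift: "w A \<sqsubseteq> ?u A" if "y \<notin> A" for A
    using that by (simp add: merge_def below_add_left)
  have u_x: "?u (insert x A) = w (insert x A) + w (insert y A)" if "x \<notin> A" "y \<notin> A" for A
    using that \<open>x \<noteq> y\<close> by (simp add: merge_def)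
  have lift_z: "w (insert z A) \<sqsubseteq> ?u (insert x A)" if "x \<notin> A" "y \<notin> A" "z \<in> {x, y}" for z A
    using that u_x[of A] below_add_left below_add_right by auto
  have u_0: "?u A = w A" if "x \<notin> A" "y \<notin> A" for A
    using that by (simp add: merge_def)
  have "?u I * ?u J \<sqsubseteq> g"
  proof (cases "y \<in> I \<or> y \<in> J")
    case True
    then have "?u I * ?u J = 0" by (auto simp: merge_def)
    then show ?thesis by (simp add: zero_below)
  next
    case False
    then have y: "y \<notin> I" "y \<notin> J" "p \<noteq> y" using p by auto
    define K L where "K = I - {x}" and "L = J - {x}"
    have KL: "finite K" "finite L" "x \<notin> K \<union> L" "y \<notin> K \<union> L"
      using fin y by (auto simp: K_def L_def)
    consider (both) "x \<in> I" "x \<in> J" | (left) "x \<in> I" "x \<notin> J" | (right) "x \<notin> I" "x \<in> J"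
      | (none) "x \<notin> I" "x \<notin> J" by blast
    then show ?thesis
    proof cases
      case none
      then have "w I * w J \<sqsubseteq> g"
        using y p by (intro exchange_bound[OF ex fin p] g) (auto intro!: lift)
      then show ?thesis using none y by (simp add: u_0)
    next
      case left
      have I: "I = insert x K" using left by (auto simp: K_def)
      have "w (insert z K) * w J \<sqsubseteq> g" if z: "z \<in> {x, y}" for z
      proof (rule exchange_bound[OF ex, where p = p])
        fix i assume i: "i \<in> insert z K - J"
        show "w (insert p (insert z K - {i})) * w (insert i (J - {p})) \<sqsubseteq> g"
        proof (cases "i = z")
          case True
          have "insert p (insert z K - {i}) = insert p (I - {x})"
            using True z KL I by auto
          then have "w (insert p (insert z K - {i})) \<sqsubseteq> ?u (insert p (I - {x}))"
            using y by (auto intro!: lift)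
          moreover have "w (insert i (J - {p})) \<sqsubseteq> ?u (insert x (J - {p}))"
            using True left y z by (intro lift_z) auto
          moreover have "x \<in> I - J" using left by simp
          ultimately show ?thesis by (rule g[rotated])
        next
          case False
          have iIJ: "i \<in> I - J" and "i \<noteq> x" "i \<noteq> y" using False i I KL by auto
          have *: "insert p (insert z K - {i}) = insert z (insert p (K - {i}))"
            "insert p (I - {i}) = insert x (insert p (K - {i}))"
            using False z KL I i by auto
          have "w (insert p (insert z K - {i})) \<sqsubseteq> ?u (insert p (I - {i}))"
            unfolding * using z KL left p y by (intro lift_z) auto
          moreover have "w (insert i (J - {p})) \<sqsubseteq> ?u (insert i (J - {p}))"
            using y \<open>i \<noteq> y\<close> by (auto intro!: lift)
          ultimately show ?thesis by (rule g[OF iIJ])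
        qed
      qed (use KL fin p z y left in \<open>auto simp: K_def\<close>)
      then show ?thesis
        using u_x[of K] u_0[of J] KL y left I by (simp add: distrib_right add_below)
    next
      case right
      have J: "J = insert x L" using right by (auto simp: L_def)
      have "w I * w (insert z L) \<sqsubseteq> g" if z: "z \<in> {x, y}" for z
      proof (cases "p = x")
        case True
        show ?thesis
        proof (rule exchange_bound[OF ex, where p = z])
          fix i assume i: "i \<in> I - insert z L"
          then have iIJ: "i \<in> I - J" using right J by auto
          have *: "insert i (insert z L - {z}) = insert i L" "insert i (J - {p}) = insert i L"
            using True z KL J by auto
          have "w (insert z (I - {i})) \<sqsubseteq> ?u (insert p (I - {i}))"
            unfolding True using z right y by (auto intro!: lift_z)
          moreover have "w (insert i (insert z L - {z})) \<sqsubseteq> ?u (insert i (J - {p}))"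
            unfolding * using iIJ y KL by (auto intro!: lift)
          ultimately show "w (insert z (I - {i})) * w (insert i (insert z L - {z})) \<sqsubseteq> g"
            by (rule g[OF iIJ])
        qed (use KL fin z y right in auto)
      next
        case False
        show ?thesis
        proof (rule exchange_bound[OF ex, where p = p])
          fix i assume i: "i \<in> I - insert z L"
          then have iIJ: "i \<in> I - J" using right J by auto
          have *: "insert i (insert z L - {p}) = insert z (insert i (L - {p}))"
            "insert i (J - {p}) = insert x (insert i (L - {p}))"
            using False z KL J p y by auto
          have "w (insert p (I - {i})) \<sqsubseteq> ?u (insert p (I - {i}))"
            using y by (auto intro!: lift)
          moreover have "w (insert i (insert z L - {p})) \<sqsubseteq> ?u (insert i (J - {p}))"
            unfolding * using iIJ z KL right y by (intro lift_z) auto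
          ultimately show "w (insert p (I - {i})) * w (insert i (insert z L - {p})) \<sqsubseteq> g"
            by (rule g[OF iIJ])
        qed (use KL fin p z y right False in \<open>auto simp: L_def\<close>)
      qed
      then show ?thesis
        using u_x[of L] u_0[of I] KL y right J by (simp add: distrib_left add_below)
    next
      case both
      have IJ: "I = insert x K" "J = insert x L" using both by (auto simp: K_def L_def)
      have p': "p \<in> L - K" "p \<noteq> x" using p both by (auto simp: L_def K_def)
      have good: "w (insert z (insert p (K - {i}))) * w (insert z' (insert i (L - {p}))) \<sqsubseteq> g"
        if "i \<in> K - L" "z \<in> {x, y}" "z' \<in> {x, y}" for i z z'
      proof (rule g[of i])
        have *: "insert p (I - {i}) = insert x (insert p (K - {i}))"
          "insert i (J - {p}) = insert x (insert i (L - {p}))"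
          using that IJ p' KL by auto
        show "i \<in> I - J" using that IJ KL by auto
        show "w (insert z (insert p (K - {i}))) \<sqsubseteq> ?u (insert p (I - {i}))"
          "w (insert z' (insert i (L - {p}))) \<sqsubseteq> ?u (insert i (J - {p}))"
          unfolding * using that KL p' y by (auto intro!: lift_z)
      qed
      have same: "w (insert z K) * w (insert z L) \<sqsubseteq> g" if z: "z \<in> {x, y}" for z
      proof (rule exchange_bound[OF ex, where p = p])
        fix i assume i: "i \<in> insert z K - insert z L"
        then have "insert p (insert z K - {i}) = insert z (insert p (K - {i}))"
          "insert i (insert z L - {p}) = insert z (insert i (L - {p}))"
          using z p' y by auto
        then show "w (insert p (insert z K - {i})) * w (insert i (insert z L - {p})) \<sqsubseteq> g"
          using good[of i z z] i z by auto
      qed (use KL p' z y in auto)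
      \<comment> \<open>The crossed products: regrouping \<open>?s * ?t\<close> into uncrossed factors bounds it by \<open>g * g\<close>.\<close>
      let ?s = "w (insert x K) * w (insert y L)" and ?t = "w (insert y K) * w (insert x L)"
      have s: "?s \<sqsubseteq> g + ?t" and t: "?t \<sqsubseteq> g + ?s"
        using KL p' \<open>x \<noteq> y\<close>
        by (intro crossed_exchange[OF ex, where p = p] good; auto)+
      have "?s * ?t = (w (insert x K) * w (insert x L)) * (w (insert y K) * w (insert y L))"
        by (simp add: ac_simps)
      also have "\<dots> \<sqsubseteq> g * g"
        by (intro mult_below_mono same) auto
      finally have st: "?s * ?t \<sqsubseteq> g * g" .
      then have "?s \<sqsubseteq> g" "?t \<sqsubseteq> g"
        using below_of_mult_below_square[OF s] below_of_mult_below_square[OF t]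
        by (simp_all add: mult.commute)
      then show ?thesis
        using same[of x] same[of y] u_x[of K] u_x[of L] KL IJ
        by (simp add: distrib_left distrib_right add_below)
    qed
  qed
  then show "?u I * ?u J \<sqsubseteq> (\<Sum>i\<in>I - J. ?u (insert p (I - {i})) * ?u (insert i (J - {p})))"
    by (simp add: g_def)
qed

section \<open>Valuated matroid union\<close>

definition disjoint_union_product :: "('a set \<Rightarrow> 's::idempotent_semifield) \<Rightarrow> ('a set \<Rightarrow> 's) \<Rightarrow> 'a set \<Rightarrow> 's"
  where "disjoint_union_product w w' K = (\<Sum>T\<in>Pow K. w (K - T) * w' T)"

text \<open>The product of \<open>w\<close> and \<open>w'\<close> on two copies \<open>Inl\<close>, \<open>Inr\<close> of the ground set, after \<open>Inr i\<close>
  has been merged into \<open>Inl i\<close> for all \<open>i \<in> P\<close>. A set \<open>T\<close> collects the merged elements whose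
  preimage is taken in the second copy.\<close>

definition partial_merge :: "('a set \<Rightarrow> 's::idempotent_semifield) \<Rightarrow> ('a set \<Rightarrow> 's) \<Rightarrow> 'a set \<Rightarrow>
    ('a + 'a) set \<Rightarrow> 's"
  where "partial_merge w w' P K =
    (if \<exists>i\<in>P. Inr i \<in> K then 0
     else \<Sum>T\<in>Pow {i\<in>P. Inl i \<in> K}. w (Inl -` K - T) * w' (Inr -` K \<union> T))"

text \<open>Before any merging, \<open>p\<close> lies in one of the two copies; the exchange takes place there and the
  other factor is carried along.\<close>

lemma exchange_partial_merge_empty:
  assumes "exchange w" "exchange w'"
  shows "exchange (partial_merge w w' {})"
  unfolding exchange_def
proof (intro allI impI)
  fix I J :: "('a + 'a) set" and p
  assume fin: "finite I" "finite J" and p: "p \<in> J - I"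
  let ?u = "partial_merge w w' {}"
  let ?b = "\<Sum>i\<in>I - J. ?u (insert p (I - {i})) * ?u (insert i (J - {p}))"
  have u: "?u K = w (Inl -` K) * w' (Inr -` K)" for K
    by (simp add: partial_merge_def)
  have bound: "?u (insert p (I - {i})) * ?u (insert i (J - {p})) \<sqsubseteq> ?b" if "i \<in> I - J" for i
    using fin that by (intro below_sum) auto
  have fin': "finite (Inl -` I)" "finite (Inl -` J)" "finite (Inr -` I)" "finite (Inr -` J)"
    using fin by (auto intro: finite_vimageI)
  show "?u I * ?u J \<sqsubseteq> ?b"
  proof (cases p)
    case (Inl a)
    let ?c = "w' (Inr -` I) * w' (Inr -` J)"
    have "w (Inl -` I) * w (Inl -` J) \<sqsubseteq> (\<Sum>i\<in>Inl -` I - Inl -` J.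
        w (insert a (Inl -` I - {i})) * w (insert i (Inl -` J - {a})))"
      using fin' p Inl by (intro exchangeD assms) auto
    then have "?c * (w (Inl -` I) * w (Inl -` J)) \<sqsubseteq> ?c * (\<Sum>i\<in>Inl -` I - Inl -` J.
        w (insert a (Inl -` I - {i})) * w (insert i (Inl -` J - {a})))"
      by (rule mult_below_left)
    also have "\<dots> \<sqsubseteq> ?b"
      unfolding sum_distrib_left
    proof (rule sum_below)
      fix i assume i: "i \<in> Inl -` I - Inl -` J"
      have "?c * (w (insert a (Inl -` I - {i})) * w (insert i (Inl -` J - {a}))) =
          ?u (insert p (I - {Inl i})) * ?u (insert (Inl i) (J - {p}))"
      proof -
        have "Inl -` insert p (I - {Inl i}) = insert a (Inl -` I - {i})"
          "Inr -` insert p (I - {Inl i}) = Inr -` I"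
          "Inl -` insert (Inl i) (J - {p}) = insert i (Inl -` J - {a})"
          "Inr -` insert (Inl i) (J - {p}) = Inr -` J"
          using Inl by auto
        then show ?thesis by (simp add: u ac_simps)
      qed
      then show "?c * (w (insert a (Inl -` I - {i})) * w (insert i (Inl -` J - {a}))) \<sqsubseteq> ?b"
        using bound[of "Inl i"] i by simp
    qed
    finally show ?thesis by (simp add: u ac_simps)
  next
    case (Inr a)
    let ?c = "w (Inl -` I) * w (Inl -` J)"
    have "w' (Inr -` I) * w' (Inr -` J) \<sqsubseteq> (\<Sum>i\<in>Inr -` I - Inr -` J.
        w' (insert a (Inr -` I - {i})) * w' (insert i (Inr -` J - {a})))"
      using fin' p Inr by (intro exchangeD assms) auto
    then have "?c * (w' (Inr -` I) * w' (Inr -` J)) \<sqsubseteq> ?c * (\<Sum>i\<in>Inr -` I - Inr -` J.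
        w' (insert a (Inr -` I - {i})) * w' (insert i (Inr -` J - {a})))"
      by (rule mult_below_left)
    also have "\<dots> \<sqsubseteq> ?b"
      unfolding sum_distrib_left
    proof (rule sum_below)
      fix i assume i: "i \<in> Inr -` I - Inr -` J"
      have "?c * (w' (insert a (Inr -` I - {i})) * w' (insert i (Inr -` J - {a}))) =
          ?u (insert p (I - {Inr i})) * ?u (insert (Inr i) (J - {p}))"
      proof -
        have "Inr -` insert p (I - {Inr i}) = insert a (Inr -` I - {i})"
          "Inl -` insert p (I - {Inr i}) = Inl -` I"
          "Inr -` insert (Inr i) (J - {p}) = insert i (Inr -` J - {a})"
          "Inl -` insert (Inr i) (J - {p}) = Inl -` J"
          using Inr by auto
        then show ?thesis by (simp add: u ac_simps)
      qed
      then show "?c * (w' (insert a (Inr -` I - {i})) * w' (insert i (Inr -` J - {a}))) \<sqsubseteq> ?b"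
        using bound[of "Inr i"] i by simp
    qed
    finally show ?thesis by (simp add: u ac_simps)
  qed
qed

lemma partial_merge_insert:
  assumes "finite P" "a \<notin> P"
  shows "partial_merge w w' (insert a P) = merge (Inl a) (Inr a) (partial_merge w w' P)"
proof
  fix K
  let ?K' = "insert (Inr a) (K - {Inl a})"
  let ?Q = "{i\<in>P. Inl i \<in> K}"
  let ?f = "\<lambda>T. w (Inl -` K - T) * w' (Inr -` K \<union> T)"
  show "partial_merge w w' (insert a P) K = merge (Inl a) (Inr a) (partial_merge w w' P) K"
  proof (cases "\<exists>i\<in>insert a P. Inr i \<in> K")
    case True
    then show ?thesis by (auto simp: partial_merge_def merge_def)
  next
    case False
    then have no: "\<not> (\<exists>i\<in>P. Inr i \<in> K)" "Inr a \<notin> K" by auto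
    show ?thesis
    proof (cases "Inl a \<in> K")
      case False
      then have "{i\<in>insert a P. Inl i \<in> K} = ?Q" by auto
      then show ?thesis using False no by (simp add: partial_merge_def merge_def)
    next
      case True
      have Q': "{i\<in>P. Inl i \<in> ?K'} = ?Q" using assms by auto
      have "\<not> (\<exists>i\<in>P. Inr i \<in> ?K')" using no assms by auto
      then have "partial_merge w w' P ?K' =
          (\<Sum>T\<in>Pow ?Q. w (Inl -` ?K' - T) * w' (Inr -` ?K' \<union> T))"
        unfolding partial_merge_def Q' by simp
      also have "\<dots> = (\<Sum>T\<in>Pow ?Q. ?f (insert a T))"
        by (intro sum.cong arg_cong2[where f = times] arg_cong[where f = w] arg_cong[where f = w'])
          auto
      also have "\<dots> = sum ?f (insert a ` Pow ?Q)"
        using assms by (subst sum.reindex) (auto simp: inj_on_def)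
      finally have K': "partial_merge w w' P ?K' = sum ?f (insert a ` Pow ?Q)" .
      have "{i\<in>insert a P. Inl i \<in> K} = insert a ?Q" using True by auto
      then have "partial_merge w w' (insert a P) K = sum ?f (Pow (insert a ?Q))"
        using no by (simp add: partial_merge_def)
      also have "\<dots> = sum ?f (Pow ?Q) + sum ?f (insert a ` Pow ?Q)"
        unfolding Pow_insert using assms by (intro sum.union_disjoint) auto
      also have "\<dots> = merge (Inl a) (Inr a) (partial_merge w w' P) K"
        using no True K' by (simp add: merge_def) (simp add: partial_merge_def)
      finally show ?thesis .
    qed
  qed
qed

lemma exchange_partial_merge:
  assumes "exchange w" "exchange w'" "finite P"
  shows "exchange (partial_merge w w' P)"
  using assms(3)
proof (induction P rule: finite_induct)
  case empty
  show ?case using assms(1,2) by (rule exchange_partial_merge_empty)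
next
  case (insert a P)
  then show ?case by (simp add: partial_merge_insert exchange_merge)
qed

text \<open>An instance of the exchange property involves only subsets of \<open>I \<union> J\<close>. On these, the
  disjoint union product is what remains after all pairs of copies of elements of \<open>I \<union> J\<close> have been
  merged.\<close>

theorem exchange_disjoint_union_product:
  fixes w w' :: "'a set \<Rightarrow> 's::idempotent_semifield"
  assumes "exchange w" "exchange w'"
  shows "exchange (disjoint_union_product w w')"
  unfolding exchange_def
proof (intro allI impI)
  fix I J :: "'a set" and p
  assume fin: "finite I" "finite J" and p: "p \<in> J - I"
  let ?v = "partial_merge w w' (I \<union> J)"
  have v: "?v (Inl ` K) = disjoint_union_product w w' K" if "K \<subseteq> I \<union> J" for K
  proof -
    have "{i \<in> I \<union> J. Inl i \<in> (Inl ` K :: ('a + 'a) set)} = K"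
      "Inl -` (Inl ` K :: ('a + 'a) set) = K" "Inr -` (Inl ` K :: ('a + 'a) set) = {}"
      using that by auto
    then show ?thesis
      by (auto simp: partial_merge_def disjoint_union_product_def)
  qed
  have "?v (Inl ` I) * ?v (Inl ` J) \<sqsubseteq>
      (\<Sum>i\<in>Inl ` I - Inl ` J. ?v (insert (Inl p) (Inl ` I - {i})) * ?v (insert i (Inl ` J - {Inl p})))"
    using fin p by (intro exchangeD exchange_partial_merge assms) auto
  also have "Inl ` I - Inl ` J = (Inl ` (I - J) :: ('a + 'a) set)"
    by auto
  also have "(\<Sum>i\<in>Inl ` (I - J).
        ?v (insert (Inl p) (Inl ` I - {i})) * ?v (insert i (Inl ` J - {Inl p}))) =
      (\<Sum>i\<in>I - J. ?v (Inl ` insert p (I - {i})) * ?v (Inl ` insert i (J - {p})))"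
  proof (rule sum.reindex_cong[where l = Inl])
    fix i
    have "Inl ` insert p (I - {i}) = insert (Inl p) (Inl ` I - {Inl i :: 'a + 'a})"
      "Inl ` insert i (J - {p}) = insert (Inl i) (Inl ` J - {Inl p :: 'a + 'a})"
      by auto
    then show "?v (insert (Inl p) (Inl ` I - {Inl i})) * ?v (insert (Inl i) (Inl ` J - {Inl p})) =
        ?v (Inl ` insert p (I - {i})) * ?v (Inl ` insert i (J - {p}))"
      by (simp only:)
  qed simp_all
  also have "\<dots> = (\<Sum>i\<in>I - J. disjoint_union_product w w' (insert p (I - {i})) *
      disjoint_union_product w w' (insert i (J - {p})))"
    using p by (intro sum.cong HOL.refl arg_cong2[where f = times] v) auto
  finally show "disjoint_union_product w w' I * disjoint_union_product w w' J \<sqsubseteq>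
      (\<Sum>i\<in>I - J. disjoint_union_product w w' (insert p (I - {i})) *
        disjoint_union_product w w' (insert i (J - {p})))"
    by (simp add: v)
qed


section \<open>Evaluating polynomials\<close>

definition monomial_eval :: "('v \<Rightarrow> 'a::comm_semiring_1) \<Rightarrow> ('v \<Rightarrow>\<^sub>0 nat) \<Rightarrow> 'a"
  where "monomial_eval g m = (\<Prod>v\<in>Poly_Mapping.keys m. g v ^ Poly_Mapping.lookup m v)"

lemma monomial_eval_superset:
  assumes "finite A" "Poly_Mapping.keys m \<subseteq> A"
  shows "monomial_eval g m = (\<Prod>v\<in>A. g v ^ Poly_Mapping.lookup m v)"
  unfolding monomial_eval_def using assms
  by (intro prod.mono_neutral_left) (auto simp: in_keys_iff)

lemma monomial_eval_add: "monomial_eval g (m + m') = monomial_eval g m * monomial_eval g m'"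
proof -
  let ?A = "Poly_Mapping.keys m \<union> Poly_Mapping.keys m'"
  have "monomial_eval g (m + m') = (\<Prod>v\<in>?A. g v ^ Poly_Mapping.lookup (m + m') v)"
    using keys_add[of m m'] by (intro monomial_eval_superset) auto
  also have "\<dots> = (\<Prod>v\<in>?A. g v ^ Poly_Mapping.lookup m v) * (\<Prod>v\<in>?A. g v ^ Poly_Mapping.lookup m' v)"
    by (simp add: lookup_add power_add prod.distrib)
  also have "\<dots> = monomial_eval g m * monomial_eval g m'"
    by (simp add: monomial_eval_superset[where A = ?A])
  finally show ?thesis .
qed

definition substitute ::
  "('v \<Rightarrow> ('s::comm_semiring_1, 'u) free_alg) \<Rightarrow> ('s, 'v) free_alg \<Rightarrow> ('s, 'u) free_alg"
  where "substitute g p =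
    (\<Sum>m\<in>Poly_Mapping.keys p. const (Poly_Mapping.lookup p m) * monomial_eval g m)"

lemma const_zero [simp]: "const 0 = 0"
  by (simp add: const_def)

lemma const_one [simp]: "const 1 = 1"
  by (simp add: const_def)

lemma const_add: "const (a + b) = const a + const b"
  by (simp add: const_def single_add)

lemma const_mult: "const (a * b) = const a * const b"
  by (simp add: const_def mult_single)

lemma const_mult_single: "const a * Poly_Mapping.single m b = Poly_Mapping.single m (a * b)"
  by (simp add: const_def mult_single)

lemma substitute_zero [simp]: "substitute g 0 = 0"
  by (simp add: substitute_def)

lemma substitute_add: "substitute g (p + q) = substitute g p + substitute g q"
  unfolding substitute_def
  by (rule setsum_keys_plus_distrib) (simp_all add: const_add distrib_right)

lemma substitute_single: "substitute g (Poly_Mapping.single m a) = const a * monomial_eval g m"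
  by (cases "a = 0") (simp_all add: substitute_def)

lemma substitute_const [simp]: "substitute g (const a) = const a"
  using substitute_single[of g 0 a] by (simp add: const_def monomial_eval_def)

lemma substitute_var [simp]: "substitute g (var v) = g v"
  by (simp add: var_def substitute_single monomial_eval_def)

lemma free_alg_induct [case_names zero single add]:
  assumes "P 0" "\<And>m a. P (Poly_Mapping.single m a)" "\<And>p q. P p \<Longrightarrow> P q \<Longrightarrow> P (p + q)"
  shows "P (p :: ('s::comm_semiring_1, 'v) free_alg)"
proof (induction p rule: update_induct)
  case (update f a b)
  have "Poly_Mapping.update a b f = Poly_Mapping.single a b + f"
    using update(1)
    by (intro poly_mapping_eqI) (auto simp: lookup_update lookup_add lookup_single when_def in_keys_iff)
  then show ?case using assms(2,3) update by metis
qed (rule assms(1))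

lemma substitute_mult: "substitute g (p * q) = substitute g p * substitute g q"
proof (induction p rule: free_alg_induct)
  case (single m a)
  show ?case
    by (induction q rule: free_alg_induct)
      (simp_all add: mult_single substitute_single substitute_add distrib_left distrib_right const_mult
        monomial_eval_add ac_simps)
qed (simp_all add: substitute_add distrib_right)

lemma substitute_sum: "substitute g (sum f A) = (\<Sum>x\<in>A. substitute g (f x))"
  by (induction A rule: infinite_finite_induct) (simp_all add: substitute_add)

lemma substitute_one [simp]: "substitute g 1 = 1"
  using substitute_const[of g 1] by simp

lemma substitute_prod: "substitute g (prod f A) = (\<Prod>x\<in>A. substitute g (f x))"
  by (induction A rule: infinite_finite_induct) (simp_all add: substitute_mult)


section \<open>Square-free coefficients\<close>

definition squarefree_monomial :: "'u set \<Rightarrow> ('u \<Rightarrow>\<^sub>0 nat)"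
  where "squarefree_monomial K = (\<Sum>i\<in>K. Poly_Mapping.single i 1)"

lemma lookup_squarefree_monomial:
  "finite K \<Longrightarrow> Poly_Mapping.lookup (squarefree_monomial K) i = (if i \<in> K then 1 else 0)"
  by (simp add: squarefree_monomial_def lookup_sum lookup_single when_def)

lemma squarefree_monomial_eq_iff:
  assumes "finite K" "finite L"
  shows "squarefree_monomial K = squarefree_monomial L \<longleftrightarrow> K = L"
proof
  assume "squarefree_monomial K = squarefree_monomial L"
  then have "Poly_Mapping.lookup (squarefree_monomial K) i
      = Poly_Mapping.lookup (squarefree_monomial L) i" for i
    by simp
  then have "i \<in> K \<longleftrightarrow> i \<in> L" for i
    using assms by (metis lookup_squarefree_monomial one_neq_zero)
  then show "K = L" by blast
qed simp

text \<open>Factors of a square-free monomial are square-free with disjoint supports. So the square-free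
  part of a polynomial product is the disjoint union product of the square-free parts.\<close>

lemma add_eq_squarefree_monomial_iff:
  assumes "finite K"
  shows "m + m' = squarefree_monomial K \<longleftrightarrow>
    (\<exists>T\<subseteq>K. m = squarefree_monomial (K - T) \<and> m' = squarefree_monomial T)"
proof
  assume eq: "m + m' = squarefree_monomial K"
  define T where "T = Poly_Mapping.keys m'"
  have sum: "Poly_Mapping.lookup m i + Poly_Mapping.lookup m' i = (if i \<in> K then 1 else 0)" for i
    using arg_cong[OF eq, of "\<lambda>m. Poly_Mapping.lookup m i"] assms
    by (simp add: lookup_add lookup_squarefree_monomial)
  have "T \<subseteq> K"
  proof
    fix i assume "i \<in> T"
    then show "i \<in> K" using sum[of i] by (auto simp: T_def in_keys_iff split: if_splits)
  qed
  moreover have lookup_m': "Poly_Mapping.lookup m' i = (if i \<in> T then 1 else 0)" for i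
    using sum[of i] by (cases "i \<in> T"; cases "i \<in> K") (simp_all add: T_def in_keys_iff)
  moreover have "Poly_Mapping.lookup m i = (if i \<in> K - T then 1 else 0)" for i
    using sum[of i] lookup_m'[of i] \<open>T \<subseteq> K\<close> by (auto split: if_splits)
  moreover have "finite T" using \<open>T \<subseteq> K\<close> assms by (rule finite_subset)
  ultimately have "T \<subseteq> K" "m = squarefree_monomial (K - T)" "m' = squarefree_monomial T"
    using assms by (auto intro!: poly_mapping_eqI simp: lookup_squarefree_monomial)
  then show "\<exists>T\<subseteq>K. m = squarefree_monomial (K - T) \<and> m' = squarefree_monomial T"
    by blast
next
  assume "\<exists>T\<subseteq>K. m = squarefree_monomial (K - T) \<and> m' = squarefree_monomial T"
  then obtain T where "T \<subseteq> K" "m = squarefree_monomial (K - T)" "m' = squarefree_monomial T"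
    by blast
  then show "m + m' = squarefree_monomial K"
    using assms by (simp add: squarefree_monomial_def sum.subset_diff)
qed

lemma lookup_mult_squarefree:
  fixes p q :: "('s::comm_semiring_1, 'u) free_alg"
  assumes "finite K"
  shows "Poly_Mapping.lookup (p * q) (squarefree_monomial K) =
    (\<Sum>T\<in>Pow K. Poly_Mapping.lookup p (squarefree_monomial (K - T)) *
               Poly_Mapping.lookup q (squarefree_monomial T))"
proof (induction p rule: free_alg_induct)
  case (single m a)
  show ?case
  proof (induction q rule: free_alg_induct)
    case (single m' b)
    let ?f = "\<lambda>T. Poly_Mapping.lookup (Poly_Mapping.single m a) (squarefree_monomial (K - T)) *
      Poly_Mapping.lookup (Poly_Mapping.single m' b) (squarefree_monomial T)"
    show ?case
    proof (cases "m + m' = squarefree_monomial K")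
      case True
      then obtain T where T: "T \<subseteq> K" "m = squarefree_monomial (K - T)" "m' = squarefree_monomial T"
        using add_eq_squarefree_monomial_iff[OF assms] by blast
      have "?f T' = 0" if "T' \<in> Pow K - {T}" for T'
      proof -
        have "finite T'" "finite T" using that T(1) assms finite_subset by auto
        then have "squarefree_monomial T' \<noteq> squarefree_monomial T"
          using that by (simp add: squarefree_monomial_eq_iff)
        then show ?thesis by (simp add: T(3) lookup_single when_def)
      qed
      then have "sum ?f (Pow K) = sum ?f {T}"
        using T(1) assms by (intro sum.mono_neutral_right) auto
      then show ?thesis using True T by (simp add: mult_single)
    next
      case False
      have "?f T = 0" if "T \<in> Pow K" for T
        using False that add_eq_squarefree_monomial_iff[OF assms, of m m']
        by (auto simp: lookup_single when_def)
      then have "sum ?f (Pow K) = 0" by (simp add: sum.neutral)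
      then show ?thesis using False by (simp add: mult_single lookup_single)
    qed
  qed (simp_all add: distrib_left lookup_add sum.distrib)
qed (simp_all add: distrib_right lookup_add sum.distrib)

lemma var_power: "var v ^ k = Poly_Mapping.single (Poly_Mapping.single v k) 1"
  by (induction k) (simp_all add: var_def mult_single flip: single_add)

lemma prod_var: "(\<Prod>i\<in>I. var (f i)) = Poly_Mapping.single (\<Sum>i\<in>I. Poly_Mapping.single (f i) 1) 1"
  by (induction I rule: infinite_finite_induct) (simp_all add: var_def mult_single)


section \<open>Homogeneous elements\<close>

definition monomial_degree :: "('v \<Rightarrow>\<^sub>0 nat) \<Rightarrow> nat"
  where "monomial_degree m = (\<Sum>v\<in>Poly_Mapping.keys m. Poly_Mapping.lookup m v)"

lemma monomial_degree_add: "monomial_degree (m + m') = monomial_degree m + monomial_degree m'"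
  unfolding monomial_degree_def by (rule setsum_keys_plus_distrib) simp_all

lemma homogeneous_iff: "homogeneous d p \<longleftrightarrow> (\<forall>m\<in>Poly_Mapping.keys p. monomial_degree m = d)"
  by (simp add: homogeneous_def monomial_degree_def)

lemma homogeneous_mult: "homogeneous d p \<Longrightarrow> homogeneous d' q \<Longrightarrow> homogeneous (d + d') (p * q)"
  using keys_mult[of p q] by (fastforce simp: homogeneous_iff monomial_degree_add)

lemma grassmann_class_eq_iff:
  "grassmann_class scale n e p = grassmann_class scale n e q \<longleftrightarrow> grassmann_cong scale n e p q"
  unfolding grassmann_class_def grassmann_cong_def
  by (blast intro: gen_cong.refl gen_cong.sym gen_cong.trans)

context free_semimodule
begin

section \<open>The dual basis\<close>

lemma dual_basis_expansion:
  "(\<forall>i. i \<notin> {1..n} \<longrightarrow> dual_basis scale n e i v = 0) \<and>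
   v = (\<Sum>i\<in>{1..n}. scale (dual_basis scale n e i v) (e i))"
  unfolding dual_basis_def by (rule theI'[OF basis])

lemma dual_basis_unique:
  assumes "\<And>i. i \<notin> {1..n} \<Longrightarrow> c i = 0" "v = (\<Sum>i\<in>{1..n}. scale (c i) (e i))"
  shows "dual_basis scale n e i v = c i"
  using basis[of v] assms dual_basis_expansion[of v] by metis

lemma dual_basis_add:
  "dual_basis scale n e i (u + v) = dual_basis scale n e i u + dual_basis scale n e i v"
proof (rule dual_basis_unique)
  show "u + v = (\<Sum>i\<in>{1..n}. scale (dual_basis scale n e i u + dual_basis scale n e i v) (e i))"
    using dual_basis_expansion[of u] dual_basis_expansion[of v]
    by (simp add: scale_add_left sum.distrib)
qed (simp add: dual_basis_expansion)

lemma scale_sum: "scale a (sum f A) = (\<Sum>x\<in>A. scale a (f x))"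
  by (induction A rule: infinite_finite_induct) (simp_all add: scale_zero_right scale_add_right)

lemma dual_basis_scale: "dual_basis scale n e i (scale a v) = a * dual_basis scale n e i v"
proof (rule dual_basis_unique)
  have "scale a v = scale a (\<Sum>i\<in>{1..n}. scale (dual_basis scale n e i v) (e i))"
    using dual_basis_expansion[of v] by simp
  then show "scale a v = (\<Sum>i\<in>{1..n}. scale (a * dual_basis scale n e i v) (e i))"
    by (simp add: scale_sum scale_scale)
qed (simp add: dual_basis_expansion)

lemma dual_basis_self:
  assumes "j \<in> {1..n}"
  shows "dual_basis scale n e i (e j) = (if i = j then 1 else 0)"
proof (rule dual_basis_unique)
  have "(\<Sum>i\<in>{1..n}. scale (if i = j then 1 else 0) (e i)) = (\<Sum>i\<in>{1..n}. if i = j then e i else 0)"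
    by (intro sum.cong) (simp_all add: scale_one scale_zero_left)
  then show "e j = (\<Sum>i\<in>{1..n}. scale (if i = j then 1 else 0) (e i))"
    using assms by simp
qed (use assms in auto)


section \<open>The basis of the Grassmann algebra\<close>

text \<open>Substituting these polynomials for the vectors realizes \<open>Sym V\<close> as the polynomial algebra in
  \<open>n\<close> variables.\<close>

definition linear_polynomial :: "'v \<Rightarrow> ('s, nat) free_alg"
  where "linear_polynomial v = (\<Sum>i\<in>{1..n}. const (dual_basis scale n e i v) * var i)"

definition squarefree_coeff :: "('s, 'v) free_alg \<Rightarrow> nat set \<Rightarrow> 's"
  where "squarefree_coeff p I =
    Poly_Mapping.lookup (substitute linear_polynomial p) (squarefree_monomial I)"

lemma linear_polynomial_add: "linear_polynomial (u + v) = linear_polynomial u + linear_polynomial v"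
  by (simp add: linear_polynomial_def dual_basis_add const_add distrib_right sum.distrib)

lemma linear_polynomial_scale: "linear_polynomial (scale a v) = const a * linear_polynomial v"
  by (simp add: linear_polynomial_def dual_basis_scale const_mult sum_distrib_left mult.assoc)

lemma linear_polynomial_basis:
  assumes "j \<in> {1..n}"
  shows "linear_polynomial (e j) = var j"
proof -
  have "linear_polynomial (e j) = (\<Sum>i\<in>{1..n}. if i = j then var i else 0)"
    unfolding linear_polynomial_def using assms by (intro sum.cong) (simp_all add: dual_basis_self)
  then show ?thesis using assms by simp
qed

lemma squarefree_coeff_mult:
  "finite K \<Longrightarrow> squarefree_coeff (p * q) K =
    (\<Sum>T\<in>Pow K. squarefree_coeff p (K - T) * squarefree_coeff q T)"
  by (simp add: squarefree_coeff_def substitute_mult lookup_mult_squarefree)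

lemma squarefree_coeff_add:
  "squarefree_coeff (p + q) K = squarefree_coeff p K + squarefree_coeff q K"
  by (simp add: squarefree_coeff_def substitute_add lookup_add)

text \<open>The linearity relations become equalities of polynomials. Both sides of a relation
  \<open>e\<^sub>i\<^sup>2 \<sim> 0\<close> have no square-free terms. Multiplication is respected because a square-free
  coefficient of a product involves only square-free coefficients of the factors.\<close>

lemma squarefree_coeff_cong:
  assumes "grassmann_cong scale n e p q" "finite K"
  shows "squarefree_coeff p K = squarefree_coeff q K"
  using assms unfolding grassmann_cong_def
proof (induction arbitrary: K rule: gen_cong.induct)
  case (base p q)
  from base.hyps show ?case
  proof
    assume "sym_rel scale p q"
    then have "substitute linear_polynomial p = substitute linear_polynomial q"
      by cases (simp_all add: substitute_add substitute_mult linear_polynomial_add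
          linear_polynomial_scale)
    then show ?thesis by (simp add: squarefree_coeff_def)
  next
    assume "square_rel n e p q"
    then obtain i where i: "i \<in> {1..n}" and pq: "p = var (e i) ^ 2" "q = 0"
      by cases
    have "substitute linear_polynomial p = var i ^ 2"
      by (simp add: pq power2_eq_square substitute_mult linear_polynomial_basis[OF i])
    moreover have "squarefree_monomial K \<noteq> Poly_Mapping.single i 2"
    proof
      assume "squarefree_monomial K = Poly_Mapping.single i 2"
      then have "Poly_Mapping.lookup (squarefree_monomial K) i = 2" by simp
      then show False using base.prems by (simp add: lookup_squarefree_monomial split: if_splits)
    qed
    ultimately show ?thesis
      by (simp add: squarefree_coeff_def pq var_power lookup_single when_def)
  qed
next
  case (mult p q p' q')
  have "squarefree_coeff (p * p') K =
      (\<Sum>T\<in>Pow K. squarefree_coeff p (K - T) * squarefree_coeff p' T)"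
    using mult.prems by (rule squarefree_coeff_mult)
  also have "\<dots> = (\<Sum>T\<in>Pow K. squarefree_coeff q (K - T) * squarefree_coeff q' T)"
  proof (rule sum.cong[OF HOL.refl])
    fix T assume "T \<in> Pow K"
    then have "finite T" "finite (K - T)" using mult.prems finite_subset by auto
    then show "squarefree_coeff p (K - T) * squarefree_coeff p' T =
        squarefree_coeff q (K - T) * squarefree_coeff q' T"
      using mult.IH by simp
  qed
  also have "\<dots> = squarefree_coeff (q * q') K"
    using mult.prems by (rule squarefree_coeff_mult[symmetric])
  finally show ?case .
qed (simp_all add: squarefree_coeff_add)

definition basis_combination :: "nat \<Rightarrow> (nat set \<Rightarrow> 's) \<Rightarrow> ('s, 'v) free_alg"
  where "basis_combination d c =
    (\<Sum>I\<in>subsets_of_card n d. const (c I) * (\<Prod>i\<in>I. var (e i)))"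

lemma grassmann_vector_eq_class:
  "grassmann_vector scale n e d c = grassmann_class scale n e (basis_combination d c)"
  by (simp add: grassmann_vector_def basis_combination_def)

lemma grassmann_vector_cong:
  assumes "\<And>K. K \<in> subsets_of_card n d \<Longrightarrow> c K = c' K"
  shows "grassmann_vector scale n e d c = grassmann_vector scale n e d c'"
proof -
  have "basis_combination d c = basis_combination d c'"
    unfolding basis_combination_def using assms by (intro sum.cong) auto
  then show ?thesis by (simp add: grassmann_vector_eq_class)
qed

lemma finite_subsets_of_card: "finite (subsets_of_card n d)"
  by (simp add: subsets_of_card_def)

lemma finite_of_subsets_of_card: "I \<in> subsets_of_card n d \<Longrightarrow> finite I"
  by (auto simp: subsets_of_card_def intro: finite_subset)

lemma squarefree_coeff_basis_combination:
  assumes "finite K"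
  shows "squarefree_coeff (basis_combination d c) K = (if K \<in> subsets_of_card n d then c K else 0)"
proof -
  have "substitute linear_polynomial (\<Prod>i\<in>I. var (e i)) =
      Poly_Mapping.single (squarefree_monomial I) 1" if "I \<in> subsets_of_card n d" for I
  proof -
    have "substitute linear_polynomial (\<Prod>i\<in>I. var (e i)) = (\<Prod>i\<in>I. linear_polynomial (e i))"
      by (simp add: substitute_prod)
    also have "\<dots> = (\<Prod>i\<in>I. var i)"
      using that by (intro prod.cong) (auto simp: subsets_of_card_def linear_polynomial_basis)
    finally show ?thesis by (simp only: prod_var squarefree_monomial_def)
  qed
  then have "squarefree_coeff (basis_combination d c) K = (\<Sum>I\<in>subsets_of_card n d.
      Poly_Mapping.lookup (Poly_Mapping.single (squarefree_monomial I) (c I)) (squarefree_monomial K))"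
    by (simp add: squarefree_coeff_def basis_combination_def substitute_sum substitute_mult
        lookup_sum const_mult_single)
  also have "\<dots> = (\<Sum>I\<in>subsets_of_card n d. if I = K then c I else 0)"
    using assms
    by (intro sum.cong)
      (auto simp: lookup_single when_def squarefree_monomial_eq_iff finite_of_subsets_of_card)
  finally show ?thesis by (simp add: finite_subsets_of_card)
qed

abbreviation grassmann_congruent (infix \<open>\<simeq>\<close> 50)
  where "grassmann_congruent \<equiv> grassmann_cong scale n e"

lemma cong_refl: "p \<simeq> p"
  and cong_trans [trans]: "p \<simeq> q \<Longrightarrow> q \<simeq> r \<Longrightarrow> p \<simeq> r"
  and cong_add: "p \<simeq> q \<Longrightarrow> p' \<simeq> q' \<Longrightarrow> p + p' \<simeq> q + q'"
  and cong_mult: "p \<simeq> q \<Longrightarrow> p' \<simeq> q' \<Longrightarrow> p * p' \<simeq> q * q'"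
  unfolding grassmann_cong_def
  by (blast intro: gen_cong.refl gen_cong.trans gen_cong.add gen_cong.mult)+

lemma cong_sum: "(\<And>x. x \<in> A \<Longrightarrow> f x \<simeq> g x) \<Longrightarrow> sum f A \<simeq> sum g A"
  by (induction A rule: infinite_finite_induct) (simp_all add: cong_refl cong_add)

lemma cong_var_add: "var (u + v) \<simeq> var u + var v"
  and cong_var_scale: "var (scale a v) \<simeq> const a * var v"
  and cong_square: "i \<in> {1..n} \<Longrightarrow> var (e i) * var (e i) \<simeq> 0"
  unfolding grassmann_cong_def
  using square_rel.square[of i n e]
  by (auto intro!: gen_cong.base sym_rel.intros simp: power2_eq_square)

lemma cong_var_zero: "var 0 \<simeq> 0"
  using cong_var_scale[of 0 0] by (simp add: scale_zero_left)

lemma cong_var_sum: "var (sum f A) \<simeq> (\<Sum>x\<in>A. var (f x))"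
proof (induction A rule: infinite_finite_induct)
  case (insert x A)
  have "var (f x + sum f A) \<simeq> var (f x) + var (sum f A)" by (rule cong_var_add)
  also have "\<dots> \<simeq> var (f x) + (\<Sum>x\<in>A. var (f x))" by (intro cong_add cong_refl insert.IH)
  finally show ?case using insert by simp
qed (simp_all add: cong_var_zero)

lemma cong_var_expansion: "var v \<simeq> (\<Sum>i\<in>{1..n}. const (dual_basis scale n e i v) * var (e i))"
proof -
  have "var v \<simeq> (\<Sum>i\<in>{1..n}. var (scale (dual_basis scale n e i v) (e i)))"
    using cong_var_sum[of "\<lambda>i. scale (dual_basis scale n e i v) (e i)" "{1..n}"]
      dual_basis_expansion[of v] by simp
  also have "\<dots> \<simeq> (\<Sum>i\<in>{1..n}. const (dual_basis scale n e i v) * var (e i))"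
    by (intro cong_sum cong_var_scale)
  finally show ?thesis .
qed

definition spanned :: "nat \<Rightarrow> ('s, 'v) free_alg \<Rightarrow> bool"
  where "spanned d p \<longleftrightarrow> (\<exists>c. p \<simeq> basis_combination d c)"

lemma spanned_cong: "p \<simeq> q \<Longrightarrow> spanned d q \<Longrightarrow> spanned d p"
  unfolding spanned_def by (blast intro: cong_trans)

lemma spanned_zero: "spanned d 0"
proof -
  have "basis_combination d (\<lambda>_. 0) = 0" by (simp add: basis_combination_def)
  then show ?thesis unfolding spanned_def by (metis cong_refl)
qed

lemma spanned_add:
  assumes "spanned d p" "spanned d q"
  shows "spanned d (p + q)"
proof -
  obtain c c' where "p \<simeq> basis_combination d c" "q \<simeq> basis_combination d c'"
    using assms unfolding spanned_def by blast
  then have "p + q \<simeq> basis_combination d c + basis_combination d c'" by (rule cong_add)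
  also have "basis_combination d c + basis_combination d c' = basis_combination d (\<lambda>I. c I + c' I)"
    by (simp add: basis_combination_def const_add distrib_right sum.distrib)
  finally show ?thesis unfolding spanned_def by blast
qed

lemma spanned_sum: "(\<And>x. x \<in> A \<Longrightarrow> spanned d (f x)) \<Longrightarrow> spanned d (sum f A)"
  by (induction A rule: infinite_finite_induct) (simp_all add: spanned_zero spanned_add)

lemma spanned_basis_vector:
  assumes "I \<in> subsets_of_card n d"
  shows "spanned d (const a * (\<Prod>i\<in>I. var (e i)))"
proof -
  have "basis_combination d (\<lambda>J. if J = I then a else 0) =
      (\<Sum>J\<in>subsets_of_card n d. if J = I then const a * (\<Prod>i\<in>I. var (e i)) else 0)"
    unfolding basis_combination_def by (intro sum.cong) auto
  also have "\<dots> = const a * (\<Prod>i\<in>I. var (e i))"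
    using assms by (simp add: finite_subsets_of_card)
  finally show ?thesis unfolding spanned_def by (metis cong_refl)
qed

text \<open>After expanding \<open>v\<close> in the basis it remains to multiply \<open>e\<^sub>I\<close> by \<open>e\<^sub>i\<close>: this contains the factor
  \<open>e\<^sub>i\<^sup>2\<close> if \<open>i \<in> I\<close>, and is \<open>e\<^bsub>I + i\<^esub>\<close> otherwise.\<close>

lemma spanned_var_mult:
  assumes "spanned d p"
  shows "spanned (Suc d) (var v * p)"
proof -
  obtain c where "p \<simeq> basis_combination d c"
    using assms unfolding spanned_def by blast
  with cong_var_expansion[of v]
  have "var v * p \<simeq> (\<Sum>i\<in>{1..n}. const (dual_basis scale n e i v) * var (e i)) * basis_combination d c"
    by (rule cong_mult)
  moreover have "spanned (Suc d) (const a * var (e i) * (const b * (\<Prod>j\<in>I. var (e j))))"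
    if "i \<in> {1..n}" "I \<in> subsets_of_card n d" for i I a b
  proof (cases "i \<in> I")
    case True
    have "const a * var (e i) * (const b * (\<Prod>j\<in>I. var (e j))) =
        (const (a * b) * (\<Prod>j\<in>I - {i}. var (e j))) * (var (e i) * var (e i))"
      using True that finite_of_subsets_of_card
      by (simp add: prod.remove[of I i] const_mult ac_simps)
    also have "\<dots> \<simeq> (const (a * b) * (\<Prod>j\<in>I - {i}. var (e j))) * 0"
      by (intro cong_mult cong_refl cong_square that)
    finally show ?thesis by (rule spanned_cong) (simp add: spanned_zero)
  next
    case False
    then have "insert i I \<in> subsets_of_card n (Suc d)"
      using that finite_of_subsets_of_card[OF that(2)] by (auto simp: subsets_of_card_def)
    then have "spanned (Suc d) (const (a * b) * (\<Prod>j\<in>insert i I. var (e j)))"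
      by (rule spanned_basis_vector)
    then show ?thesis
      using False finite_of_subsets_of_card[OF that(2)] by (simp add: const_mult ac_simps)
  qed
  then have "spanned (Suc d)
      ((\<Sum>i\<in>{1..n}. const (dual_basis scale n e i v) * var (e i)) * basis_combination d c)"
    unfolding basis_combination_def sum_product by (intro spanned_sum) auto
  ultimately show ?thesis by (rule spanned_cong)
qed

lemma spanned_monomial: "spanned (monomial_degree m) (Poly_Mapping.single m a)"
proof (induction "monomial_degree m" arbitrary: m)
  case 0
  then have "m = 0"
    by (auto simp: monomial_degree_def in_keys_iff intro: poly_mapping_eqI)
  moreover have "{} \<in> subsets_of_card n 0" by (simp add: subsets_of_card_def)
  ultimately show ?case
    using spanned_basis_vector[of "{}" 0 a] by (simp add: const_def monomial_degree_def)
next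
  case (Suc k)
  then obtain v where "v \<in> Poly_Mapping.keys m"
    by (metis monomial_degree_def sum.empty all_not_in_conv nat.distinct(1))
  then have v: "Poly_Mapping.lookup m v > 0" by (simp add: in_keys_iff)
  define m' where "m' = m - Poly_Mapping.single v 1"
  have m: "m = Poly_Mapping.single v 1 + m'"
    using v by (intro poly_mapping_eqI) (auto simp: m'_def lookup_add lookup_minus lookup_single when_def)
  have "monomial_degree m = Suc (monomial_degree m')"
    unfolding m monomial_degree_add by (simp add: monomial_degree_def)
  then have "spanned k (Poly_Mapping.single m' a)"
    using Suc by auto
  then have "spanned (Suc k) (var v * Poly_Mapping.single m' a)"
    by (rule spanned_var_mult)
  also have "var v * Poly_Mapping.single m' a = Poly_Mapping.single m a"
    by (subst m) (simp add: var_def mult_single)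
  finally show ?case
    using Suc.hyps(2) by simp
qed

lemma spanned_homogeneous:
  assumes "homogeneous d p"
  shows "spanned d p"
proof -
  have "p = (\<Sum>m\<in>Poly_Mapping.keys p. Poly_Mapping.single m (Poly_Mapping.lookup p m))"
    by (intro poly_mapping_eqI) (auto simp: lookup_sum lookup_single when_def in_keys_iff)
  moreover have "spanned d (Poly_Mapping.single m (Poly_Mapping.lookup p m))"
    if "m \<in> Poly_Mapping.keys p" for m
    using assms that spanned_monomial[of m] by (auto simp: homogeneous_iff)
  ultimately show ?thesis using spanned_sum by metis
qed

text \<open>The coordinates of a combination of the \<open>e\<^sub>I\<close> can be read off as square-free coefficients, hence
  are determined by the congruence class. So the definite description in \<open>coordinate\<close> denotes.\<close>

lemma coordinate_grassmann_vector:
  "coordinate scale n e d (grassmann_vector scale n e d c) K =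
    (if K \<in> subsets_of_card n d then c K else 0)"
proof -
  let ?c = "\<lambda>K. if K \<in> subsets_of_card n d then c K else 0"
  have "(THE c'. (\<forall>I. I \<notin> subsets_of_card n d \<longrightarrow> c' I = 0) \<and>
      grassmann_vector scale n e d c = grassmann_vector scale n e d c') = ?c"
  proof (rule the_equality)
    have "grassmann_vector scale n e d c = grassmann_vector scale n e d ?c"
      by (rule grassmann_vector_cong) simp
    then show "(\<forall>I. I \<notin> subsets_of_card n d \<longrightarrow> ?c I = 0) \<and>
        grassmann_vector scale n e d c = grassmann_vector scale n e d ?c"
      by simp
  next
    fix c' assume c': "(\<forall>I. I \<notin> subsets_of_card n d \<longrightarrow> c' I = 0) \<and>
        grassmann_vector scale n e d c = grassmann_vector scale n e d c'"
    then have "basis_combination d c \<simeq> basis_combination d c'"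
      by (simp add: grassmann_vector_eq_class grassmann_class_eq_iff)
    then have "c K = c' K" if "K \<in> subsets_of_card n d" for K
      using squarefree_coeff_cong[of _ _ K] finite_of_subsets_of_card[OF that] that
      by (metis squarefree_coeff_basis_combination)
    then show "c' = ?c" using c' by auto
  qed
  then show ?thesis by (simp add: coordinate_def)
qed

lemma coordinate_class:
  assumes "homogeneous d p" "finite K"
  shows "coordinate scale n e d (grassmann_class scale n e p) K = squarefree_coeff p K"
proof -
  obtain c where c: "p \<simeq> basis_combination d c"
    using spanned_homogeneous[OF assms(1)] unfolding spanned_def by blast
  then have "grassmann_class scale n e p = grassmann_vector scale n e d c"
    by (simp add: grassmann_vector_eq_class grassmann_class_eq_iff)
  then show ?thesis
    using squarefree_coeff_cong[OF c assms(2)] squarefree_coeff_basis_combination[OF assms(2)]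
    by (simp add: coordinate_grassmann_vector)
qed

lemma grassmann_vector_coordinate:
  assumes "w \<in> grassmann_graded scale n e d"
  shows "grassmann_vector scale n e d (coordinate scale n e d w) = w"
proof -
  obtain p where p: "w = grassmann_class scale n e p" "homogeneous d p"
    using assms by (auto simp: grassmann_graded_def)
  then obtain c where "p \<simeq> basis_combination d c"
    using spanned_homogeneous unfolding spanned_def by blast
  with p have w: "w = grassmann_vector scale n e d c"
    by (simp add: grassmann_vector_eq_class grassmann_class_eq_iff)
  show ?thesis
    unfolding w by (rule grassmann_vector_cong) (simp add: coordinate_grassmann_vector)
qed

lemma coordinate_outside:
  assumes "w \<in> grassmann_graded scale n e d" "K \<notin> subsets_of_card n d"
  shows "coordinate scale n e d w K = 0"
  using grassmann_vector_coordinate[OF assms(1)] coordinate_grassmann_vector assms(2) by metis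

lemma coordinate_zero: "coordinate scale n e d (grassmann_class scale n e 0) K = 0"
proof -
  have "grassmann_class scale n e 0 = grassmann_vector scale n e d (\<lambda>_. 0)"
    by (simp add: grassmann_vector_def)
  then show ?thesis by (simp add: coordinate_grassmann_vector)
qed

lemma wedge_graded:
  assumes "w \<in> grassmann_graded scale n e d" "w' \<in> grassmann_graded scale n e d'"
  shows "wedge scale n e w w' \<in> grassmann_graded scale n e (d + d')"
  using assms homogeneous_mult unfolding grassmann_graded_def by (force simp: wedge_class)

lemma coordinate_wedge:
  assumes "w \<in> grassmann_graded scale n e d" "w' \<in> grassmann_graded scale n e d'"
  shows "coordinate scale n e (d + d') (wedge scale n e w w') K =
    (\<Sum>T\<in>Pow K. coordinate scale n e d w (K - T) * coordinate scale n e d' w' T)"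
proof (cases "finite K")
  case True
  obtain p q where w: "w = grassmann_class scale n e p" "w' = grassmann_class scale n e q"
    and pq: "homogeneous d p" "homogeneous d' q"
    using assms by (auto simp: grassmann_graded_def)
  have "(\<Sum>T\<in>Pow K. coordinate scale n e d w (K - T) * coordinate scale n e d' w' T) =
      (\<Sum>T\<in>Pow K. squarefree_coeff p (K - T) * squarefree_coeff q T)"
    unfolding w using True
    by (intro sum.cong HOL.refl arg_cong2[where f = times] coordinate_class pq)
      (auto dest: finite_subset)
  then show ?thesis
    using True homogeneous_mult[OF pq]
    by (simp add: w wedge_class coordinate_class squarefree_coeff_mult)
next
  case False
  then have "K \<notin> subsets_of_card n (d + d')" using finite_of_subsets_of_card by blast
  with False show ?thesis
    using coordinate_outside[OF wedge_graded[OF assms]] by simp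
qed

end


section \<open>Pluecker relations and the wedge product\<close>

text \<open>The correspondence is \<open>I = A - p\<close>, \<open>J = B + p\<close>: the summand at \<open>p\<close> is then \<open>w\<^sub>I w\<^sub>J\<close>, the other
  summands are those of the exchange, and \<open>a + b = b\<close> says \<open>a \<sqsubseteq> b\<close>.\<close>

lemma plucker_relations_iff_exchange:
  fixes c :: "nat set \<Rightarrow> 's::idempotent_semifield"
  assumes support: "\<And>K. K \<notin> subsets_of_card n d \<Longrightarrow> c K = 0"
  shows "(\<forall>A B p. A \<subseteq> {1..n} \<and> card A = d + 1 \<and> B \<subseteq> {1..n} \<and> Suc (card B) = d \<and> p \<in> A - B \<longrightarrow>
      (\<Sum>i\<in>A - B. c (A - {i}) * c (insert i B)) = (\<Sum>i\<in>A - B - {p}. c (A - {i}) * c (insert i B)))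
    \<longleftrightarrow> exchange c"
    (is "?relations \<longleftrightarrow> _")
proof -
  have relation_iff: "sum f (A - B) = sum f (A - B - {p}) \<longleftrightarrow> f p \<sqsubseteq> sum f (A - B - {p})"
    if "A \<subseteq> {1..n}" "p \<in> A - B" for A B p and f :: "nat \<Rightarrow> 's"
  proof -
    have "finite (A - B)" using that(1) by (meson finite_Diff finite_atLeastAtMost finite_subset)
    then show ?thesis using that(2) by (simp add: below_def sum.remove[of "A - B" p])
  qed
  show ?thesis
  proof
    assume relations: ?relations
    show "exchange c"
      unfolding exchange_def
    proof (intro allI impI)
      fix I J :: "nat set" and p
      assume fin: "finite I" "finite J" and p: "p \<in> J - I"
      show "c I * c J \<sqsubseteq> (\<Sum>i\<in>I - J. c (insert p (I - {i})) * c (insert i (J - {p})))"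
      proof (cases "I \<in> subsets_of_card n d \<and> J \<in> subsets_of_card n d")
        case False
        then have "c I * c J = 0" using support by auto
        then show ?thesis by (simp add: zero_below)
      next
        case True
        let ?A = "insert p I" and ?B = "J - {p}"
        let ?f = "\<lambda>i. c (?A - {i}) * c (insert i ?B)"
        have AB: "?A \<subseteq> {1..n}" "card ?A = d + 1" "?B \<subseteq> {1..n}" "Suc (card ?B) = d" "p \<in> ?A - ?B"
          using True p fin card_Suc_Diff1[of J p] by (auto simp: subsets_of_card_def)
        then have "sum ?f (?A - ?B) = sum ?f (?A - ?B - {p})"
          using relations by blast
        then have "?f p \<sqsubseteq> sum ?f (?A - ?B - {p})"
          by (rule relation_iff[OF AB(1,5), THEN iffD1])
        moreover have "?A - {p} = I" "insert p ?B = J" "?A - ?B - {p} = I - J"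
          using p by auto
        moreover have "sum ?f (I - J) =
            (\<Sum>i\<in>I - J. c (insert p (I - {i})) * c (insert i (J - {p})))"
        proof (rule sum.cong)
          fix i assume "i \<in> I - J"
          then have "?A - {i} = insert p (I - {i})" using p by auto
          then show "?f i = c (insert p (I - {i})) * c (insert i (J - {p}))" by simp
        qed simp
        ultimately show ?thesis by simp
      qed
    qed
  next
    assume exchange: "exchange c"
    show ?relations
    proof (intro allI impI, elim conjE)
      fix A B p
      assume AB: "A \<subseteq> {1..n}" "B \<subseteq> {1..n}" and p: "p \<in> A - B"
      let ?f = "\<lambda>i. c (A - {i}) * c (insert i B)"
      let ?I = "A - {p}" and ?J = "insert p B"
      have "finite A" "finite B" using AB finite_subset by blast+
      then have "c ?I * c ?J \<sqsubseteq> (\<Sum>i\<in>?I - ?J. c (insert p (?I - {i})) * c (insert i (?J - {p})))"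
        using p by (intro exchangeD[OF exchange]) auto
      also have "\<dots> = sum ?f (A - B - {p})"
      proof (rule sum.cong)
        fix i assume "i \<in> A - B - {p}"
        then have "insert p (?I - {i}) = A - {i}" "insert i (?J - {p}) = insert i B"
          using p by auto
        then show "c (insert p (?I - {i})) * c (insert i (?J - {p})) = ?f i" by simp
      qed auto
      finally show "sum ?f (A - B) = sum ?f (A - B - {p})"
        by (rule relation_iff[OF AB(1) p, THEN iffD2])
    qed
  qed
qed

lemma tropical_plucker_iff_exchange:
  fixes scale :: "'s::idempotent_semifield \<Rightarrow> 'v::comm_monoid_add \<Rightarrow> 'v"
  assumes "free_semimodule scale n e"
  shows "tropical_plucker scale n e d w \<longleftrightarrow> w \<in> grassmann_graded scale n e d \<and>
    w \<noteq> grassmann_class scale n e 0 \<and> exchange (coordinate scale n e d w)"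
proof (cases "w \<in> grassmann_graded scale n e d")
  case True
  note relations = plucker_relations_iff_exchange[of n d "coordinate scale n e d w"]
  show ?thesis
    unfolding tropical_plucker_def
    by (subst relations) (rule free_semimodule.coordinate_outside[OF assms True], assumption, rule HOL.refl)
next
  case False
  then show ?thesis by (simp add: tropical_plucker_def)
qed

lemma sum_over_partitions:
  fixes c c' :: "nat set \<Rightarrow> 's::idempotent_semifield"
  assumes "finite K" "\<And>I. card I \<noteq> d \<Longrightarrow> c I = 0" "\<And>J. card J \<noteq> d' \<Longrightarrow> c' J = 0"
  shows "(\<Sum>(I, J)\<in>{(I, J). I \<union> J = K \<and> I \<inter> J = {} \<and> card I = d \<and> card J = d'}. c I * c' J) =
    disjoint_union_product c c' K"
proof -
  let ?S = "{T \<in> Pow K. card (K - T) = d \<and> card T = d'}"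
  have "(\<Sum>(I, J)\<in>{(I, J). I \<union> J = K \<and> I \<inter> J = {} \<and> card I = d \<and> card J = d'}. c I * c' J) =
      (\<Sum>T\<in>?S. c (K - T) * c' T)"
  proof (rule sum.reindex_cong[where l = "\<lambda>T. (K - T, T)"])
    show "{(I, J). I \<union> J = K \<and> I \<inter> J = {} \<and> card I = d \<and> card J = d'} =
        (\<lambda>T. (K - T, T)) ` ?S"
    proof (intro equalityI subsetI)
      fix x assume "x \<in> {(I, J). I \<union> J = K \<and> I \<inter> J = {} \<and> card I = d \<and> card J = d'}"
      then obtain I J where x: "x = (I, J)" "I \<union> J = K" "I \<inter> J = {}" "card I = d" "card J = d'"
        by auto
      then have "I = K - J" "J \<in> Pow K" by auto
      then show "x \<in> (\<lambda>T. (K - T, T)) ` ?S"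
        using x by (intro image_eqI[where x = J]) auto
    qed auto
  qed (auto simp: inj_on_def)
  also have "\<dots> = (\<Sum>T\<in>Pow K. c (K - T) * c' T)"
  proof (rule sum.mono_neutral_left)
    show "\<forall>T\<in>Pow K - ?S. c (K - T) * c' T = 0"
    proof
      fix T assume "T \<in> Pow K - ?S"
      then consider "card (K - T) \<noteq> d" | "card T \<noteq> d'" by blast
      then show "c (K - T) * c' T = 0" by cases (simp_all add: assms(2,3))
    qed
  qed (use assms(1) in auto)
  finally show ?thesis by (simp add: disjoint_union_product_def)
qed

theorem proposition5p1p1:
  fixes scale :: "'s::idempotent_semifield \<Rightarrow> 'v::comm_monoid_add \<Rightarrow> 'v"
    and n :: nat and e :: "nat \<Rightarrow> 'v"
    and d d' :: nat and w w' :: "('s, 'v) free_alg set"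
  assumes "free_semimodule scale n e"
    and "tropical_plucker scale n e d w"
    and "tropical_plucker scale n e d' w'"
    and "\<exists>I J. I \<in> subsets_of_card n d \<and> J \<in> subsets_of_card n d' \<and> I \<inter> J = {} \<and>
               coordinate scale n e d w I \<noteq> 0 \<and> coordinate scale n e d' w' J \<noteq> 0"
  shows "has_plucker_vector scale n e (d + d')
           (stable_sum scale n e d w d' w') (wedge scale n e w w')"
proof -
  interpret free_semimodule scale n e by fact
  let ?c = "coordinate scale n e d w" and ?c' = "coordinate scale n e d' w'"
  let ?W = "wedge scale n e w w'"
  have graded: "w \<in> grassmann_graded scale n e d" "w' \<in> grassmann_graded scale n e d'"
    using assms(2,3) by (simp_all add: tropical_plucker_def)
  have W_graded: "?W \<in> grassmann_graded scale n e (d + d')"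
    using graded by (rule wedge_graded)
  have W_coordinate: "coordinate scale n e (d + d') ?W = disjoint_union_product ?c ?c'"
    by (rule ext) (simp add: coordinate_wedge[OF graded] disjoint_union_product_def)

  have "exchange ?c" "exchange ?c'"
    using assms(2,3) tropical_plucker_iff_exchange[OF assms(1)] by simp_all
  then have W_exchange: "exchange (coordinate scale n e (d + d') ?W)"
    unfolding W_coordinate by (rule exchange_disjoint_union_product)

  obtain I J where IJ: "I \<in> subsets_of_card n d" "J \<in> subsets_of_card n d'" "I \<inter> J = {}"
      "?c I \<noteq> 0" "?c' J \<noteq> 0"
    using assms(4) by blast
  have "?c (I \<union> J - J) * ?c' J \<sqsubseteq> disjoint_union_product ?c ?c' (I \<union> J)"
    unfolding disjoint_union_product_def using IJ(1,2)[THEN finite_of_subsets_of_card]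
    by (intro below_sum[where f = "\<lambda>T. ?c (I \<union> J - T) * ?c' T"]) auto
  moreover have "I \<union> J - J = I" using IJ(3) by auto
  ultimately have "coordinate scale n e (d + d') ?W (I \<union> J) \<noteq> 0"
    using mult_nonzero[OF IJ(4,5)] by (auto simp: W_coordinate dest: below_zero)
  then have W_nonzero: "?W \<noteq> grassmann_class scale n e 0"
    using coordinate_zero by auto

  have plucker: "tropical_plucker scale n e (d + d') ?W"
    unfolding tropical_plucker_iff_exchange[OF assms(1)]
    using W_graded W_nonzero W_exchange by blast

  \<comment> \<open>It remains to identify the vector that defines the stable sum with the wedge product.\<close>
  have support: "?c I = 0" if "card I \<noteq> d" for I
    using that by (intro coordinate_outside graded) (simp add: subsets_of_card_def)
  have support': "?c' J = 0" if "card J \<noteq> d'" for J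
    using that by (intro coordinate_outside graded) (simp add: subsets_of_card_def)
  have "grassmann_vector scale n e (d + d')
      (\<lambda>K. \<Sum>(I, J)\<in>{(I, J). I \<union> J = K \<and> I \<inter> J = {} \<and> card I = d \<and> card J = d'}. ?c I * ?c' J) =
    grassmann_vector scale n e (d + d') (coordinate scale n e (d + d') ?W)"
    unfolding W_coordinate
    by (intro grassmann_vector_cong sum_over_partitions support support' finite_of_subsets_of_card)
  also have "\<dots> = ?W"
    using W_graded by (rule grassmann_vector_coordinate)
  finally show ?thesis
    using plucker by (simp add: has_plucker_vector_def stable_sum_def)
qed

end
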